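(* Let $n,k\in\mathbb N$ with $n^{1/k}\in\mathbb N$, and let $N$ denote the sum of the cardinalities of the last $n$ blocks of the block stream. The algorithm $ACC_k$ described below requires $O\big(N\cdot n^{1/k}\cdot k\cdot(\log n+\log|\mathcal U|)\big)$ bits of space.
   Context: Block setting: elements come from a universe $\mathcal U$; a block algorithm processes a stream of blocks (each block is a set of elements; each element is added at most once to a given block) via ADD$(x)$ (add $x$ to the newest block) and ENDBLOCK() (a new empty block becomes the newest one). The window consists of the last $n$ blocks. For $w\le n$, $g_x^w$ is the number of blocks among the last $w$ blocks that contain $x$, and $g_x^{i,j}=g_x^j-g_x^i$. Algorithm $ACC_k$: let $d=n^{1/k}$. The block stream is partitioned into consecutive frames of $n$ blocks. Within a frame, each block is a level-0 segment, and for $1\le \ell\le k$ a level-$\ell$ segment consists of $d$ consecutive level-$(\ell-1)$ segments (so a level-$\ell$ segment has $d^\ell$ blocks and the level-$k$ segment is the whole frame). Every table is a hash table mapping element identifiers to counters. For each level $\ell\in\{0,\ldots,k-1\}$, when a level-$\ell$ segment ends, the algorithm stores a level-$\ell$ table for it recording, for each element, the number of blocks containing it from the beginning of the enclosing level-$(\ell+1)$ segment up to the end of this segment. It also keeps $k$ incomplete tables (one per level $\ell$) holding these cumulative counts for segments that have started but not yet ended (each ADD$(x)$ increments $x$'s entry in all $k$ incomplete tables, and the level-$\ell$ incomplete table is emptied when a level-$(\ell+1)$ segment begins), and $k$ ghost tables storing, for each level, the table of the most recent block whose level-$\ell$ table was overwritten when the window slid past it. Tables are indexed by level and block offset within the frame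 and are overwritten in the next frame.
   Formalization: Space and N (sum of cardinalities of the last n blocks) are both taken as maxima over the run, with N > 0: at a single moment the bound fails, since stored tables can still count large blocks that have left the window, and at N = 0 the bound is zero bits. *)

theory Defs
  imports Complex_Main
begin

datatype 'a stream_op = ADD 'a | ENDBLOCK

text \<open>The list of blocks has the newest block, which may still be growing, at its head.\<close>

fun block_step :: "'a set list \<Rightarrow> 'a stream_op \<Rightarrow> 'a set list" where
  "block_step [] (ADD x) = [{x}]"
| "block_step (B # Bs) (ADD x) = insert x B # Bs"
| "block_step Bs ENDBLOCK = {} # Bs"

definition blocks :: "'a stream_op list \<Rightarrow> 'a set list" where
  "blocks ops = foldl block_step [{}] ops"

definition block_stream :: "'a set \<Rightarrow> 'a stream_op list \<Rightarrow> bool" where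
  "block_stream U ops \<longleftrightarrow>
     (\<forall>i < length ops. \<forall>x. ops ! i = ADD x \<longrightarrow> x \<in> U \<and> x \<notin> hd (blocks (take i ops)))"

definition window_total :: "nat \<Rightarrow> 'a stream_op list \<Rightarrow> nat" where
  "window_total n ops = sum_list (map card (take n (blocks ops)))"

text \<open>A hash table is the finite partial map from identifiers to counters that it stores.\<close>

type_synonym 'a table = "'a \<Rightarrow> nat option"

definition increment :: "'a \<Rightarrow> 'a table \<Rightarrow> 'a table" where
  "increment x T = T(x \<mapsto> (case T x of None \<Rightarrow> 1 | Some c \<Rightarrow> c + 1))"

text \<open>
  \<open>offset\<close> is the position of the newest block within its frame, in \<open>{0..<n}\<close>.
  The table of a level-\<open>l\<close> segment is \<open>stored s l j\<close>, where \<open>j\<close> is the offset of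
  the last block of the segment. Only levels below \<open>k\<close> are used.
\<close>

record 'a acc_state =
  offset :: nat
  incomplete :: "nat \<Rightarrow> 'a table"
  stored :: "nat \<Rightarrow> nat \<Rightarrow> 'a table"
  ghost :: "nat \<Rightarrow> 'a table"

definition branching :: "nat \<Rightarrow> nat \<Rightarrow> nat" where
  "branching n k = nat \<lfloor>root k (real n)\<rfloor>"

definition acc_init :: "'a acc_state" where
  "acc_init = \<lparr> offset = 0, incomplete = (\<lambda>l. Map.empty),
     stored = (\<lambda>l j. Map.empty), ghost = (\<lambda>l. Map.empty) \<rparr>"

definition acc_add :: "nat \<Rightarrow> 'a \<Rightarrow> 'a acc_state \<Rightarrow> 'a acc_state" where
  "acc_add k x s = s\<lparr> incomplete :=
     (\<lambda>l. if l < k then increment x (incomplete s l) else incomplete s l) \<rparr>"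

text \<open>
  The block at offset \<open>j\<close> ends a level-\<open>l\<close> segment iff \<open>d ^ l\<close> divides \<open>j + 1\<close>.
  The stored table at offset \<open>j\<close>, if any, belongs to the block \<open>n\<close> positions earlier, which
  has left the window; it moves to the ghost table. The next block starts a level-\<open>(l + 1)\<close>
  segment iff \<open>d ^ (l + 1)\<close> divides \<open>j + 1\<close>.
\<close>

definition acc_endblock :: "nat \<Rightarrow> nat \<Rightarrow> 'a acc_state \<Rightarrow> 'a acc_state" where
  "acc_endblock n k s =
     (let d = branching n k; j = offset s; ends = (\<lambda>l. d ^ l dvd j + 1) in
      \<lparr> offset = (j + 1) mod n,
        incomplete = (\<lambda>l. if l < k \<and> ends (l + 1) then Map.empty else incomplete s l),
        stored = (\<lambda>l. if l < k \<and> ends l then (stored s l)(j := incomplete s l) else stored s l),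
        ghost = (\<lambda>l. if l < k \<and> ends l then stored s l j else ghost s l) \<rparr>)"

fun acc_step :: "nat \<Rightarrow> nat \<Rightarrow> 'a acc_state \<Rightarrow> 'a stream_op \<Rightarrow> 'a acc_state" where
  "acc_step n k s (ADD x) = acc_add k x s"
| "acc_step n k s ENDBLOCK = acc_endblock n k s"

definition acc_run :: "nat \<Rightarrow> nat \<Rightarrow> 'a stream_op list \<Rightarrow> 'a acc_state" where
  "acc_run n k ops = foldl (acc_step n k) acc_init ops"

text \<open>Bits of a fixed-width field that distinguishes \<open>m\<close> values.\<close>

definition bit_width :: "nat \<Rightarrow> nat" where
  "bit_width m = nat \<lceil>log 2 (real m)\<rceil>"

text \<open>
  An entry is an identifier from the universe and a counter. Elements with count 0 have no
  entry and no count exceeds \<open>n\<close>, so a counter takes one of the \<open>n\<close> values \<open>1, \<dots>, n\<close>.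
\<close>

definition table_bits :: "nat \<Rightarrow> 'a set \<Rightarrow> 'a table \<Rightarrow> nat" where
  "table_bits n U T = card (dom T) * (bit_width (card U) + bit_width n)"

definition state_bits :: "nat \<Rightarrow> nat \<Rightarrow> 'a set \<Rightarrow> 'a acc_state \<Rightarrow> nat" where
  "state_bits n k U s =
     bit_width n +
     (\<Sum>l<k. table_bits n U (incomplete s l) + table_bits n U (ghost s l)
             + (\<Sum>j<n. table_bits n U (stored s l j)))"

text \<open>
  Both the space and the window total vary as the stream is read, and both are taken at their
  maximum over the run. They cannot be compared at a single moment: a stored table counts from
  the start of its enclosing segment, so it can contain many elements of blocks that have
  already left the window, however small the current window total is.
\<close>

definition acc_space :: "nat \<Rightarrow> nat \<Rightarrow> 'a set \<Rightarrow> 'a stream_op list \<Rightarrow> nat" where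
  "acc_space n k U ops = (MAX i\<in>{..length ops}. state_bits n k U (acc_run n k (take i ops)))"

definition max_window_total :: "nat \<Rightarrow> 'a stream_op list \<Rightarrow> nat" where
  "max_window_total n ops = (MAX i\<in>{..length ops}. window_total n (take i ops))"

end

theory Submission
  imports Defs
begin

text \<open>
  Every table at level \<open>l\<close> only contains elements of a run of blocks inside one
  level-\<open>(l + 1)\<close> segment, and such a run fits into some window, so it has at most \<open>N\<close> entries.
  This settles the incomplete and the ghost tables. The stored tables at one level come from
  distinct blocks among the last \<open>n\<close> completed ones, and they count blocks among
  the last \<open>2 n\<close>. A fixed block is counted by at most \<open>d\<close> of them,
  because a level-\<open>(l + 1)\<close> segment has only \<open>d\<close> subsegments of level \<open>l\<close>.
  Since \<open>2 n\<close> blocks are covered by two windows, the stored tables of a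
  level have at most \<open>2 d N\<close> entries in total.
\<close>

section \<open>Blocks in chronological order\<close>

text \<open>Oldest block first, so that a block keeps its index while the stream grows; in
  \<open>blocks\<close> every \<open>ENDBLOCK\<close> shifts all positions.\<close>

definition chron :: "'a stream_op list \<Rightarrow> 'a set list" where
  "chron ops = rev (blocks ops)"

definition newest :: "'a stream_op list \<Rightarrow> nat" where
  "newest ops = length (blocks ops) - 1"

lemma block_step_neq_Nil: "block_step Bs opn \<noteq> []"
  by (cases "(Bs, opn)" rule: block_step.cases) auto

lemma blocks_snoc: "blocks (ops @ [opn]) = block_step (blocks ops) opn"
  by (simp add: blocks_def)

lemma blocks_neq_Nil: "blocks ops \<noteq> []"
  by (cases ops rule: rev_cases) (simp_all add: blocks_snoc block_step_neq_Nil, simp add: blocks_def)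

lemma length_chron: "length (chron ops) = Suc (newest ops)"
  using blocks_neq_Nil[of ops] by (simp add: chron_def newest_def)

lemma newest_Nil: "newest [] = 0"
  by (simp add: newest_def blocks_def)

lemma newest_ADD: "newest (ops @ [ADD x]) = newest ops"
  using blocks_neq_Nil[of ops] by (cases "blocks ops") (simp_all add: newest_def blocks_snoc)

lemma newest_ENDBLOCK: "newest (ops @ [ENDBLOCK]) = Suc (newest ops)"
  using blocks_neq_Nil[of ops] by (cases "blocks ops") (simp_all add: newest_def blocks_snoc)

lemma chron_ADD_old: "i < newest ops \<Longrightarrow> chron (ops @ [ADD x]) ! i = chron ops ! i"
  using blocks_neq_Nil[of ops]
  by (cases "blocks ops") (simp_all add: newest_def chron_def blocks_snoc nth_append)

lemma chron_ADD_newest: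
  "chron (ops @ [ADD x]) ! newest ops = insert x (chron ops ! newest ops)"
  using blocks_neq_Nil[of ops]
  by (cases "blocks ops") (simp_all add: newest_def chron_def blocks_snoc nth_append)

lemma chron_ENDBLOCK_old: "i \<le> newest ops \<Longrightarrow> chron (ops @ [ENDBLOCK]) ! i = chron ops ! i"
  using blocks_neq_Nil[of ops]
  by (cases "blocks ops") (auto simp add: newest_def chron_def blocks_snoc nth_append)

lemma chron_snoc_old:
  assumes "i < newest (ops @ [opn])"
  shows "i \<le> newest ops" and "chron (ops @ [opn]) ! i = chron ops ! i"
  using assms by (cases opn; simp add: newest_ADD newest_ENDBLOCK chron_ADD_old chron_ENDBLOCK_old)+

text \<open>Since \<open>card\<close> of an infinite set is 0, bounding a cardinality through an
  inclusion requires finite blocks.\<close>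

lemma finite_block: "B \<in> set (blocks ops) \<Longrightarrow> finite B"
proof (induction ops arbitrary: B rule: rev_induct)
  case Nil
  then show ?case by (simp add: blocks_def)
next
  case (snoc opn ops)
  then show ?case
    by (cases "(blocks ops, opn)" rule: block_step.cases) (auto simp: blocks_snoc)
qed

lemma finite_chron: "i \<le> newest ops \<Longrightarrow> finite (chron ops ! i)"
  using finite_block[of "chron ops ! i" ops] nth_mem[of i "chron ops"] length_chron[of ops]
  by (simp add: chron_def)

section \<open>Window totals over runs of blocks\<close>

lemma window_total_eq:
  "window_total n ops = (\<Sum>i\<in>{Suc (newest ops) - n..newest ops}. card (chron ops ! i))"
proof -
  let ?m = "newest ops"
  have len: "length (blocks ops) = Suc ?m"
    using length_chron[of ops] by (simp add: chron_def)
  have "window_total n ops = (\<Sum>i<min (Suc ?m) n. card (blocks ops ! i))"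
    by (simp add: window_total_def sum_list_sum_nth len atLeast0LessThan)
  also have "\<dots> = (\<Sum>i\<in>{Suc ?m - n..?m}. card (chron ops ! i))"
    by (rule sum.reindex_bij_witness[where i = "\<lambda>i. ?m - i" and j = "\<lambda>i. ?m - i"])
      (auto simp: chron_def rev_nth len)
  finally show ?thesis .
qed

text \<open>A block changes only while it is the newest. At the last prefix whose newest block lies
  in \<open>I\<close>, the current window covers all of \<open>I\<close>, and later operations leave
  these blocks as they are.\<close>

lemma sum_card_chron_le:
  fixes ops :: "'a stream_op list"
  assumes "\<forall>i\<le>length ops. window_total n (take i ops) \<le> N"
    and "I \<subseteq> {a..<a + n}" and "I \<subseteq> {..newest ops}"
  shows "(\<Sum>i\<in>I. card (chron ops ! i)) \<le> N"
  using assms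
proof (induction ops rule: rev_induct)
  case Nil
  have "(\<Sum>i\<in>I. card (chron ([] :: 'a stream_op list) ! i)) = 0"
    using Nil.prems(3) by (intro sum.neutral) (auto simp: newest_Nil chron_def blocks_def)
  then show ?case by simp
next
  case (snoc opn ops)
  let ?ops = "ops @ [opn]"
  show ?case
  proof (cases "newest ?ops \<in> I")
    case True
    then have "newest ?ops < a + n"
      using snoc.prems(2) by auto
    \<comment> \<open>Here \<open>a\<close> is at least \<open>Suc (newest ?ops) - n\<close>, the
      left end of the current window.\<close>
    then have "I \<subseteq> {Suc (newest ?ops) - n..newest ?ops}"
      using snoc.prems(2,3) by (auto dest!: subsetD)
    then have "(\<Sum>i\<in>I. card (chron ?ops ! i)) \<le> window_total n ?ops"
      unfolding window_total_eq by (intro sum_mono2) auto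
    also have "\<dots> \<le> N"
      using snoc.prems(1)[rule_format, of "length ?ops"] by simp
    finally show ?thesis .
  next
    case False
    then have old: "i < newest ?ops" if "i \<in> I" for i
      using that snoc.prems(3) by (metis atMost_iff le_neq_implies_less subsetD)
    have "(\<Sum>i\<in>I. card (chron ?ops ! i)) = (\<Sum>i\<in>I. card (chron ops ! i))"
      using chron_snoc_old(2)[OF old] by (intro sum.cong) auto
    also have "\<dots> \<le> N"
    proof (rule snoc.IH[OF _ snoc.prems(2)])
      show "\<forall>i\<le>length ops. window_total n (take i ops) \<le> N"
      proof (intro allI impI)
        fix i assume "i \<le> length ops"
        then show "window_total n (take i ops) \<le> N"
          using snoc.prems(1)[rule_format, of i] by simp
      qed
      show "I \<subseteq> {..newest ops}"
        using chron_snoc_old(1)[OF old] by auto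
    qed
    finally show ?thesis .
  qed
qed

section \<open>Elements seen since the start of a segment\<close>

text \<open>With \<open>D = d ^ (l + 1)\<close>, the elements seen from the start of the level-\<open>(l + 1)\<close> segment
  around block \<open>t\<close> up to \<open>t\<close>.\<close>

definition seen :: "'a stream_op list \<Rightarrow> nat \<Rightarrow> nat \<Rightarrow> 'a set" where
  "seen ops D t = (\<Union>i\<in>{t - t mod D..t}. chron ops ! i)"

lemma seen_snoc: "t < newest (ops @ [opn]) \<Longrightarrow> seen (ops @ [opn]) D t = seen ops D t"
  unfolding seen_def by (intro SUP_cong) (auto simp: chron_snoc_old(2))

lemma finite_seen: "t \<le> newest ops \<Longrightarrow> finite (seen ops D t)"
  by (auto simp: seen_def finite_chron)

lemma card_seen_le:
  "card (seen ops D t) \<le> (\<Sum>i\<in>{t - t mod D..t}. card (chron ops ! i))"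
  unfolding seen_def by (rule card_UN_le) simp

lemma seen_ADD_newest: "seen (ops @ [ADD x]) D (newest ops) = insert x (seen ops D (newest ops))"
proof -
  let ?m = "newest ops"
  have split: "{?m - ?m mod D..?m} = insert ?m {?m - ?m mod D..<?m}"
    by auto
  have "(\<Union>i\<in>{?m - ?m mod D..<?m}. chron (ops @ [ADD x]) ! i)
      = (\<Union>i\<in>{?m - ?m mod D..<?m}. chron ops ! i)"
    by (intro SUP_cong) (auto simp: chron_ADD_old)
  then show ?thesis
    unfolding seen_def split by (simp add: chron_ADD_newest)
qed

text \<open>The next block does not open a new segment, so both runs have the same start. In the
  excluded case the algorithm empties the incomplete table instead.\<close>

lemma seen_ENDBLOCK_newest:
  assumes "\<not> D dvd Suc (newest ops)"
  shows "seen ops D (newest ops) \<subseteq> seen (ops @ [ENDBLOCK]) D (Suc (newest ops))"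
proof -
  let ?m = "newest ops"
  have "Suc ?m mod D = Suc (?m mod D)"
    using assms by (auto simp: mod_Suc dvd_eq_mod_eq_0 split: if_splits)
  then have "Suc ?m - Suc ?m mod D = ?m - ?m mod D"
    by simp
  then show ?thesis
    by (force simp: seen_def chron_ENDBLOCK_old)
qed

section \<open>The invariant of the algorithm\<close>

text \<open>Space depends only on domains, so counter values are not tracked. The witness
  \<open>t\<close> is the absolute index of the block whose table occupies slot \<open>j\<close>;
  \<open>newest ops \<le> t + n\<close> places it among the last \<open>n\<close> completed blocks.
  A ghost table may come from any earlier block.\<close>

definition acc_invariant :: "nat \<Rightarrow> nat \<Rightarrow> nat \<Rightarrow> 'a stream_op list \<Rightarrow> 'a acc_state \<Rightarrow> bool" where
  "acc_invariant n d l ops s \<longleftrightarrow>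
     offset s = newest ops mod n \<and>
     dom (incomplete s l) \<subseteq> seen ops (d ^ Suc l) (newest ops) \<and>
     (\<forall>j<n. dom (stored s l j) = {} \<or>
        (\<exists>t<newest ops. newest ops \<le> t + n \<and> t mod n = j \<and> d ^ l dvd Suc t \<and>
           dom (stored s l j) \<subseteq> seen ops (d ^ Suc l) t)) \<and>
     (dom (ghost s l) = {} \<or>
        (\<exists>t<newest ops. dom (ghost s l) \<subseteq> seen ops (d ^ Suc l) t))"

text \<open>Frames consist of whole segments, so testing for a segment end on the offset agrees with
  testing on the absolute index.\<close>

lemma dvd_Suc_mod_iff: "(e::nat) dvd n \<Longrightarrow> e dvd Suc (m mod n) \<longleftrightarrow> e dvd Suc m"
  by (metis dvd_eq_mod_eq_0 mod_Suc_eq mod_mod_cancel)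

lemma acc_invariant_run:
  assumes "n = d ^ k" and "branching n k = d" and "n \<ge> 1" and "l < k"
  shows "acc_invariant n d l ops (acc_run n k ops)"
proof (induction ops rule: rev_induct)
  case Nil
  show ?case
    by (simp add: acc_invariant_def acc_run_def acc_init_def newest_Nil)
next
  case (snoc opn ops)
  define s where "s = acc_run n k ops"
  let ?m = "newest ops" and ?D = "d ^ Suc l"
  have run: "acc_run n k (ops @ [opn]) = acc_step n k s opn"
    by (simp add: s_def acc_run_def)
  have inv: "acc_invariant n d l ops s"
    using snoc by (simp add: s_def)
  have off: "offset s = ?m mod n"
    and inc: "dom (incomplete s l) \<subseteq> seen ops ?D ?m"
    and sto: "\<And>j. j < n \<Longrightarrow> dom (stored s l j) = {} \<or>
        (\<exists>t<?m. ?m \<le> t + n \<and> t mod n = j \<and> d ^ l dvd Suc t \<and> dom (stored s l j) \<subseteq> seen ops ?D t)"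
    and gho: "dom (ghost s l) = {} \<or> (\<exists>t<?m. dom (ghost s l) \<subseteq> seen ops ?D t)"
    using inv unfolding acc_invariant_def by blast+
  show ?case
  proof (cases opn)
    case (ADD x)
    have old: "seen (ops @ [ADD x]) ?D t = seen ops ?D t" if "t < ?m" for t
      by (rule seen_snoc) (simp add: newest_ADD that)
    have fields: "offset (acc_add k x s) = offset s" "stored (acc_add k x s) = stored s"
      "ghost (acc_add k x s) = ghost s" "incomplete (acc_add k x s) l = increment x (incomplete s l)"
      using \<open>l < k\<close> by (simp_all add: acc_add_def)
    have inc_new: "dom (increment x (incomplete s l)) \<subseteq> seen (ops @ [ADD x]) ?D ?m"
      using inc unfolding increment_def seen_ADD_newest by auto
    have sto_new: "dom (stored s l j) = {} \<or> (\<exists>t<?m. ?m \<le> t + n \<and> t mod n = j \<and> d ^ l dvd Suc t \<and>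
        dom (stored s l j) \<subseteq> seen (ops @ [ADD x]) ?D t)" if "j < n" for j
      using sto[OF that] old by metis
    have gho_new: "dom (ghost s l) = {} \<or> (\<exists>t<?m. dom (ghost s l) \<subseteq> seen (ops @ [ADD x]) ?D t)"
      using gho old by metis
    show ?thesis
      unfolding run unfolding ADD acc_invariant_def newest_ADD acc_step.simps fields
      by (intro conjI allI impI off inc_new sto_new gho_new)
  next
    case ENDBLOCK
    let ?s = "acc_endblock n k s" and ?ops = "ops @ [ENDBLOCK]"
    have "?D dvd n" and "d ^ l dvd n"
      unfolding \<open>n = d ^ k\<close> using \<open>l < k\<close> by (auto intro!: le_imp_power_dvd simp del: power_Suc)
    note ends = dvd_Suc_mod_iff[OF \<open>?D dvd n\<close>, of ?m] dvd_Suc_mod_iff[OF \<open>d ^ l dvd n\<close>, of ?m]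
    have jn: "?m mod n < n" using \<open>n \<ge> 1\<close> by simp
    have old: "seen ?ops ?D t = seen ops ?D t" if "t \<le> ?m" for t
      by (rule seen_snoc) (use that in \<open>simp add: newest_ENDBLOCK\<close>)
    have off': "offset ?s = Suc ?m mod n"
      by (simp add: acc_endblock_def Let_def off mod_Suc_eq)
    have inc': "incomplete ?s l = (if ?D dvd Suc ?m then Map.empty else incomplete s l)"
      using \<open>l < k\<close> ends by (simp add: acc_endblock_def Let_def off assms(2))
    have sto': "stored ?s l =
        (if d ^ l dvd Suc ?m then (stored s l)(?m mod n := incomplete s l) else stored s l)"
      using \<open>l < k\<close> ends by (simp add: acc_endblock_def Let_def off assms(2))
    have gho': "ghost ?s l = (if d ^ l dvd Suc ?m then stored s l (?m mod n) else ghost s l)"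
      using \<open>l < k\<close> ends by (simp add: acc_endblock_def Let_def off assms(2))
    have inc_new: "dom (incomplete ?s l) \<subseteq> seen ?ops ?D (Suc ?m)"
      using inc seen_ENDBLOCK_newest[of ?D ops] by (auto simp add: inc' simp del: power_Suc)
    have sto_new: "dom (stored ?s l j) = {} \<or> (\<exists>t<Suc ?m. Suc ?m \<le> t + n \<and> t mod n = j \<and>
        d ^ l dvd Suc t \<and> dom (stored ?s l j) \<subseteq> seen ?ops ?D t)" if "j < n" for j
    proof (cases "j = ?m mod n")
      case True
      show ?thesis
      proof (cases "d ^ l dvd Suc ?m")
        case ends_now: True
        then show ?thesis
          using inc old[of ?m] \<open>n \<ge> 1\<close> \<open>j = ?m mod n\<close>
          by (intro disjI2 exI[of _ ?m]) (simp add: sto' del: power_Suc)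
      next
        case False
        \<comment> \<open>Slots are filled only at segment ends, and \<open>n\<close> is a multiple
          of \<open>d ^ l\<close>: a nonempty table in this slot would force \<open>?m\<close> to
          end a segment as well.\<close>
        have "dom (stored s l j) = {}"
          using sto[OF that]
        proof
          assume "\<exists>t<?m. ?m \<le> t + n \<and> t mod n = j \<and> d ^ l dvd Suc t \<and>
            dom (stored s l j) \<subseteq> seen ops ?D t"
          then obtain t where "t mod n = j" "d ^ l dvd Suc t"
            by blast
          then have "d ^ l dvd Suc ?m"
            using dvd_Suc_mod_iff[OF \<open>d ^ l dvd n\<close>] True by metis
          with False show ?thesis by simp
        qed
        with False show ?thesis by (simp add: sto')
      qed
    next
      case False
      then have eq: "stored ?s l j = stored s l j" by (simp add: sto')
      show ?thesis
        using sto[OF that]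
      proof
        assume "dom (stored s l j) = {}"
        then show ?thesis by (simp add: eq)
      next
        assume "\<exists>t<?m. ?m \<le> t + n \<and> t mod n = j \<and> d ^ l dvd Suc t \<and>
            dom (stored s l j) \<subseteq> seen ops ?D t"
        then obtain t where t: "t < ?m" "?m \<le> t + n" "t mod n = j" "d ^ l dvd Suc t"
          "dom (stored s l j) \<subseteq> seen ops ?D t" by blast
        \<comment> \<open>This gives the strict inequality needed for \<open>Suc ?m\<close>: with
          equality, \<open>t\<close> would occupy slot \<open>?m mod n\<close>, which is excluded in
          this case.\<close>
        have "?m \<noteq> t + n" using t(3) False by auto
        with t old[of t] show ?thesis
          by (intro disjI2 exI[of _ t]) (simp add: eq del: power_Suc)
      qed
    qed
    have gho_new: "dom (ghost ?s l) = {} \<or> (\<exists>t<Suc ?m. dom (ghost ?s l) \<subseteq> seen ?ops ?D t)"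
    proof -
      have "dom (ghost ?s l) = {} \<or> (\<exists>t<?m. dom (ghost ?s l) \<subseteq> seen ops ?D t)"
        unfolding gho' using gho sto[OF jn]
        by (cases "d ^ l dvd Suc ?m") (simp_all only: if_True if_False, blast)
      then show ?thesis
      proof
        assume "\<exists>t<?m. dom (ghost ?s l) \<subseteq> seen ops ?D t"
        then obtain t where "t < ?m" "dom (ghost ?s l) \<subseteq> seen ops ?D t" by blast
        with old[of t] show ?thesis
          by (intro disjI2 exI[of _ t] conjI) simp_all
      qed (rule disjI1)
    qed
    show ?thesis
      unfolding run unfolding ENDBLOCK acc_invariant_def newest_ENDBLOCK acc_step.simps
      by (intro conjI allI impI off' inc_new sto_new gho_new)
  qed
qed

section \<open>Counting table entries\<close>

text \<open>Bounds the number of tables that count block \<open>i\<close>. Every \<open>t\<close> in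
  \<open>T\<close> ends a level-\<open>l\<close> segment inside the level-\<open>(l + 1)\<close>
  segment of \<open>i\<close>, where level-\<open>l\<close> segments are told apart by their rank
  \<open>(t div d ^ l) mod d\<close>.\<close>

lemma card_segment_ends_le:
  fixes d :: nat
  assumes "d \<ge> 1" and "T \<subseteq> {t. d ^ l dvd Suc t \<and> t - t mod d ^ Suc l \<le> i \<and> i \<le> t}"
  shows "card T \<le> d"
proof -
  let ?e = "d ^ l"
  have e: "?e > 0" using assms(1) by simp
  \<comment> \<open>The end of a segment is determined by the number of the segment, which makes
    \<open>t div ?e\<close> injective on \<open>T\<close>.\<close>
  have t_eq: "Suc t = ?e * Suc (t div ?e)" if "t \<in> T" for t
  proof -
    have "?e dvd Suc t" using that assms(2) by auto
    then have "Suc (t mod ?e) = ?e"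
      using e by (auto simp: mod_Suc dvd_eq_mod_eq_0 split: if_splits)
    then show ?thesis
      using mult_div_mod_eq[of ?e t] by (metis add_Suc_right mult_Suc_right add.commute)
  qed
  have same: "t div d ^ Suc l = i div d ^ Suc l" if "t \<in> T" for t
  proof (rule antisym)
    have "t - t mod d ^ Suc l \<le> i" "i \<le> t" using that assms(2) by auto
    then show "i div d ^ Suc l \<le> t div d ^ Suc l" by (intro div_le_mono)
    have "d ^ Suc l * (t div d ^ Suc l) \<le> i"
      using \<open>t - t mod d ^ Suc l \<le> i\<close> by (simp add: minus_mod_eq_mult_div)
    then show "t div d ^ Suc l \<le> i div d ^ Suc l"
      using assms(1) by (simp add: less_eq_div_iff_mult_less_eq mult.commute del: power_Suc)
  qed
  have "inj_on (\<lambda>t. (t div ?e) mod d) T"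
  proof (rule inj_onI)
    fix t t' assume tt: "t \<in> T" "t' \<in> T" "(t div ?e) mod d = (t' div ?e) mod d"
    have "(t div ?e) div d = (t' div ?e) div d"
      using same[OF tt(1)] same[OF tt(2)] by (simp only: power_Suc2 div_mult2_eq)
    then have "t div ?e = t' div ?e"
      using tt(3) by (metis mult_div_mod_eq)
    then show "t = t'"
      using t_eq[OF tt(1)] t_eq[OF tt(2)] by simp
  qed
  moreover have "(\<lambda>t. (t div ?e) mod d) ` T \<subseteq> {..<d}"
    using assms(1) by auto
  ultimately show ?thesis
    using card_inj_on_le[of _ T "{..<d}"] by simp
qed

text \<open>A union has at most as many elements as its blocks together, and the run has at most
  \<open>d ^ Suc l \<le> n\<close> blocks.\<close>

lemma card_dom_le:
  assumes "\<forall>i\<le>length ops. window_total n (take i ops) \<le> N"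
    and "d ^ Suc l \<le> n" and "d \<ge> 1"
    and "t \<le> newest ops" and "dom T \<subseteq> seen ops (d ^ Suc l) t"
  shows "card (dom T) \<le> N"
proof -
  let ?D = "d ^ Suc l"
  have "card (dom T) \<le> card (seen ops ?D t)"
    using assms by (intro card_mono finite_seen)
  also have "\<dots> \<le> (\<Sum>i\<in>{t - t mod ?D..t}. card (chron ops ! i))"
    by (rule card_seen_le)
  also have "\<dots> \<le> N"
  proof (rule sum_card_chron_le[OF assms(1)])
    have "t mod ?D < ?D" using assms(3) by simp
    then show "{t - t mod ?D..t} \<subseteq> {t - t mod ?D..<t - t mod ?D + n}"
      using assms(2) mod_less_eq_dividend[of t ?D] by auto
    show "{t - t mod ?D..t} \<subseteq> {..newest ops}" using assms(4) by auto
  qed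
  finally show ?thesis .
qed

text \<open>Double counting: bound each table by the sizes of the blocks it counts, swap the two
  sums, and charge each block for the at most \<open>d\<close> tables that count it.\<close>

lemma sum_card_stored_le:
  assumes win: "\<forall>i\<le>length ops. window_total n (take i ops) \<le> N"
    and inv: "acc_invariant n d l ops s"
    and "d ^ Suc l \<le> n" and "d \<ge> 1"
  shows "(\<Sum>j<n. card (dom (stored s l j))) \<le> 2 * d * N"
proof -
  let ?D = "d ^ Suc l" and ?m = "newest ops"
  define w where "w i = card (chron ops ! i)" for i
  define J where "J = {j. j < n \<and> dom (stored s l j) \<noteq> {}}"
  have "\<forall>j\<in>J. \<exists>t. t < ?m \<and> ?m \<le> t + n \<and> t mod n = j \<and> d ^ l dvd Suc t \<and>
      dom (stored s l j) \<subseteq> seen ops ?D t"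
    using inv unfolding acc_invariant_def J_def by blast
  then obtain \<tau> where \<tau>: "\<And>j. j \<in> J \<Longrightarrow> \<tau> j < ?m \<and> ?m \<le> \<tau> j + n \<and> \<tau> j mod n = j \<and>
      d ^ l dvd Suc (\<tau> j) \<and> dom (stored s l j) \<subseteq> seen ops ?D (\<tau> j)"
    by metis
  define T where "T = \<tau> ` J"
  have "finite J" by (simp add: J_def)
  \<comment> \<open>Reduction modulo \<open>n\<close> is a left inverse of
    \<open>\<tau>\<close>.\<close>
  have inj: "inj_on \<tau> J" using \<tau> by (metis inj_onI)
  have T: "t < ?m" "?m \<le> t + n" "d ^ l dvd Suc t" if "t \<in> T" for t
    using that \<tau> by (auto simp: T_def)
  have "finite T" using \<open>finite J\<close> by (simp add: T_def)
  \<comment> \<open>Witnesses are at least \<open>?m - n\<close> and runs have at most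
    \<open>n\<close> blocks, so all counted blocks lie in \<open>?I\<close>; the growing block
    \<open>?m\<close> is not among them.\<close>
  let ?I = "{?m - 2 * n..<?m}"
  have "(\<Sum>j<n. card (dom (stored s l j))) = (\<Sum>j\<in>J. card (dom (stored s l j)))"
    by (rule sum.mono_neutral_right) (auto simp: J_def)
  also have "\<dots> \<le> (\<Sum>j\<in>J. card (seen ops ?D (\<tau> j)))"
  proof (rule sum_mono)
    fix j assume "j \<in> J"
    with \<tau>[of j] show "card (dom (stored s l j)) \<le> card (seen ops ?D (\<tau> j))"
      by (intro card_mono finite_seen) auto
  qed
  also have "\<dots> = (\<Sum>t\<in>T. card (seen ops ?D t))"
    unfolding T_def using inj by (simp add: sum.reindex)
  also have "\<dots> \<le> (\<Sum>t\<in>T. \<Sum>i\<in>{t - t mod ?D..t}. w i)"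
    unfolding w_def by (intro sum_mono card_seen_le)
  \<comment> \<open>Runs become conditions on the fixed index set \<open>?I\<close>, which allows
    the swap.\<close>
  also have "\<dots> = (\<Sum>t\<in>T. \<Sum>i | i \<in> ?I \<and> (t - t mod ?D \<le> i \<and> i \<le> t). w i)"
  proof (rule sum.cong[OF refl], rule sum.cong[OF _ refl])
    fix t assume "t \<in> T"
    have "t mod ?D < ?D" using assms(4) by simp
    then show "{t - t mod ?D..t} = {i. i \<in> ?I \<and> (t - t mod ?D \<le> i \<and> i \<le> t)}"
      using T[OF \<open>t \<in> T\<close>] assms(3) by auto
  qed
  also have "\<dots> = (\<Sum>i\<in>?I. \<Sum>t | t \<in> T \<and> (t - t mod ?D \<le> i \<and> i \<le> t). w i)"
    by (rule sum.swap_restrict) (use \<open>finite T\<close> in auto)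
  also have "\<dots> = (\<Sum>i\<in>?I. card {t. t \<in> T \<and> (t - t mod ?D \<le> i \<and> i \<le> t)} * w i)"
    by simp
  also have "\<dots> \<le> (\<Sum>i\<in>?I. d * w i)"
    by (intro sum_mono mult_right_mono card_segment_ends_le[where l = l, OF assms(4)]) (use T in auto)
  also have "\<dots> = d * (\<Sum>i\<in>?I. w i)"
    by (simp add: sum_distrib_left)
  \<comment> \<open>Both halves have at most \<open>n\<close> consecutive blocks, hence total at
    most \<open>N\<close>.\<close>
  also have "(\<Sum>i\<in>?I. w i) = (\<Sum>i\<in>{?m - 2 * n..<?m - n} \<union> {?m - n..<?m}. w i)"
    by (rule sum.cong) auto
  also have "\<dots> = (\<Sum>i\<in>{?m - 2 * n..<?m - n}. w i) + (\<Sum>i\<in>{?m - n..<?m}. w i)"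
    by (rule sum.union_disjoint) auto
  also have "\<dots> \<le> N + N"
    unfolding w_def
    by (intro add_mono sum_card_chron_le[OF win, of _ "?m - 2 * n"]
        sum_card_chron_le[OF win, of _ "?m - n"]) auto
  finally show ?thesis by (simp add: algebra_simps)
qed

section \<open>From entries to bits\<close>

text \<open>Per level, the incomplete and the ghost table contribute at most \<open>N\<close>
  entries each and the stored tables \<open>2 * d * N\<close>, together at most
  \<open>4 * (d * N)\<close>. The fifth share pays for the offset field, as \<open>k * d * N\<close>
  is at least 1.\<close>

lemma state_bits_le:
  assumes win: "\<forall>i\<le>length ops. window_total n (take i ops) \<le> N"
    and "n = d ^ k" and "branching n k = d" and "n \<ge> 1" and "d \<ge> 1" and "k \<ge> 1" and "N \<ge> 1"
  shows "state_bits n k U (acc_run n k ops)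
    \<le> 5 * (k * d * N) * (bit_width (card U) + bit_width n)"
proof -
  let ?s = "acc_run n k ops" and ?b = "bit_width (card U) + bit_width n"
  have level: "table_bits n U (incomplete ?s l) + table_bits n U (ghost ?s l)
      + (\<Sum>j<n. table_bits n U (stored ?s l j)) \<le> 4 * (d * N) * ?b" if "l < k" for l
  proof -
    have inv: "acc_invariant n d l ops ?s"
      using acc_invariant_run assms that by blast
    have D: "d ^ Suc l \<le> n"
      unfolding \<open>n = d ^ k\<close> using assms(5) that by (intro power_increasing) auto
    note dom_le = card_dom_le[OF win D assms(5)]
    have inc: "card (dom (incomplete ?s l)) \<le> N"
      using inv unfolding acc_invariant_def by (intro dom_le[of "newest ops"]) auto
    have "dom (ghost ?s l) = {} \<or> (\<exists>t<newest ops. dom (ghost ?s l) \<subseteq> seen ops (d ^ Suc l) t)"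
      using inv unfolding acc_invariant_def by blast
    then have gho: "card (dom (ghost ?s l)) \<le> N"
      using dom_le less_imp_le by (metis card.empty zero_le)
    have sto: "(\<Sum>j<n. card (dom (stored ?s l j))) \<le> 2 * d * N"
      by (rule sum_card_stored_le[OF win inv D assms(5)])
    have "N \<le> d * N" using assms(5) by simp
    with inc gho sto have "card (dom (incomplete ?s l)) + card (dom (ghost ?s l))
        + (\<Sum>j<n. card (dom (stored ?s l j))) \<le> 4 * (d * N)"
      by linarith
    from mult_right_mono[OF this, of ?b] show ?thesis
      by (simp only: table_bits_def sum_distrib_right add_mult_distrib)
  qed
  have "state_bits n k U ?s \<le> bit_width n + (\<Sum>l<k. 4 * (d * N) * ?b)"
    unfolding state_bits_def using level by (intro add_left_mono sum_mono) auto
  also have "\<dots> \<le> 1 * ?b + 4 * (k * d * N) * ?b"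
    by (simp add: algebra_simps)
  also have "\<dots> \<le> (k * d * N) * ?b + 4 * (k * d * N) * ?b"
    using assms by (intro add_right_mono mult_right_mono) auto
  also have "\<dots> = 5 * (k * d * N) * ?b"
    by (simp only: flip: add_mult_distrib) simp
  finally show ?thesis .
qed

text \<open>For \<open>m = 0\<close> this relies on the junk value \<open>log 2 0 = 0\<close>.\<close>

lemma bit_width_le: "real (bit_width m) \<le> 2 * log 2 (real m)"
proof (cases "m \<ge> 2")
  case True
  \<comment> \<open>Once the logarithm is at least 1, rounding it up at most doubles it.\<close>
  then have "1 \<le> log 2 (real m)" by simp
  then show ?thesis unfolding bit_width_def by linarith
next
  case False
  then have "m = 0 \<or> m = 1" by auto
  then show ?thesis by (auto simp: bit_width_def log_def)
qed

theorem theorem3: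
  shows "\<exists>C::real. \<forall>(n::nat) (k::nat) (U::'a set) (ops::'a stream_op list) (N::nat).
    n \<ge> 1 \<longrightarrow> k \<ge> 1 \<longrightarrow> root k (real n) \<in> \<nat> \<longrightarrow>
    finite U \<longrightarrow> block_stream U ops \<longrightarrow>
    N = max_window_total n ops \<longrightarrow> N > 0 \<longrightarrow>
    real (acc_space n k U ops)
      \<le> C * (real N * root k (real n) * real k * (log 2 (real n) + log 2 (real (card U))))"
\<comment> \<open>The constant 10 is the factor 5 of \<open>state_bits_le\<close> times the factor 2
  lost in rounding field widths up to whole bits.\<close>
proof (intro exI[of _ 10] allI impI)
  fix n k :: nat and U :: "'a set" and ops :: "'a stream_op list" and N :: nat
  assume "n \<ge> 1" "k \<ge> 1" "root k (real n) \<in> \<nat>" and N: "N = max_window_total n ops" "N > 0"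
  then obtain d where d: "root k (real n) = real d"
    by (auto elim: Nats_cases)
  have "real n = real (d ^ k)"
    using real_root_pow_pos2[of k "real n"] \<open>k \<ge> 1\<close> d by simp
  then have n: "n = d ^ k" by (simp only: of_nat_eq_iff)
  have "d \<ge> 1" using n \<open>n \<ge> 1\<close> \<open>k \<ge> 1\<close> by (cases "d = 0") (auto simp: power_0_left)
  have br: "branching n k = d" by (simp add: branching_def d)
  have win: "window_total n (take i ops) \<le> N" if "i \<le> length ops" for i
    unfolding N max_window_total_def by (rule Max_ge) (use that in auto)
  let ?b = "bit_width (card U) + bit_width n"
  have "acc_space n k U ops \<le> 5 * (k * d * N) * ?b"
    unfolding acc_space_def
  proof (rule Max.boundedI)
    fix a assume "a \<in> (\<lambda>i. state_bits n k U (acc_run n k (take i ops))) ` {..length ops}"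
    then obtain i where "i \<le> length ops" and a: "a = state_bits n k U (acc_run n k (take i ops))"
      by auto
    \<comment> \<open>Prefixes of \<open>take i ops\<close> are prefixes of \<open>ops\<close>, so
      the same \<open>N\<close> bounds all their window totals.\<close>
    then show "a \<le> 5 * (k * d * N) * ?b"
      unfolding a using n br \<open>n \<ge> 1\<close> \<open>d \<ge> 1\<close> \<open>k \<ge> 1\<close> N(2) win
      by (intro state_bits_le) (auto simp: min_def)
  qed auto
  then have "real (acc_space n k U ops) \<le> real (5 * (k * d * N) * ?b)"
    by (simp only: of_nat_le_iff)
  also have "\<dots> = 5 * (real k * real d * real N) * real ?b"
    by simp
  also have "\<dots> \<le> 5 * (real k * real d * real N) * (2 * (log 2 (real n) + log 2 (real (card U))))"
    using bit_width_le[of n] bit_width_le[of "card U"] by (intro mult_left_mono) auto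
  finally show "real (acc_space n k U ops)
      \<le> 10 * (real N * root k (real n) * real k * (log 2 (real n) + log 2 (real (card U))))"
    by (simp add: d algebra_simps)
qed

end
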